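(* Let $r$ be a revenue profile as in the context, and for each $\gamma\in\mathbb{R}$ let $\eta^{\mathrm{opt}}=\eta^{\mathrm{opt}}(\gamma)$ be the unique solution $\eta\ge0$ of the threshold equation $r(\eta)=R_{\mathrm T}(\eta)$. Suppose $r$ has a cusp at $x=0$, i.e. $r_{\mathrm R}'(0+)<0<r_{\mathrm L}'(0-)$. Then, as $\gamma\to-\infty$, $$\eta^{\mathrm{opt}}=-\frac1\gamma\ln\Bigl(1-\frac{r_{\mathrm L}'(0-)}{r_{\mathrm R}'(0+)}\Bigr)+O\Bigl(\frac1{\gamma^2}\Bigr).$$
   Context: $\phi,\Phi$ are the standard normal density and distribution function. The revenue profile $r:\mathbb{R}\to[0,1]$ does not depend on $\gamma$. It is continuous with $r(0)=1$; its restrictions $r_{\mathrm L}$ to $(-\infty,0]$ and $r_{\mathrm R}$ to $[0,\infty)$ are piecewise smooth (finitely many breakpoints, bounded derivatives, smooth up to the endpoint $0$ from the respective side); it is nondecreasing on $(-\infty,0]$; it is nonincreasing on $[0,\infty)$, strictly decreasing on $\{x\ge0:r(x)>0\}$, and $r(x)\to0$ as $x\to\infty$. $r_{\mathrm L}'(0-)$ and $r_{\mathrm R}'(0+)$ are the left and right derivatives of $r$ at $0$. For $\eta\ge0$ and $\gamma\in\mathbb{R}$, $$R_{\mathrm T}(\eta)=\frac{\int_{-\infty}^0 r(x)e^{-\frac12x^2-\gamma x}\,dx+\int_0^\eta r(x)e^{-\gamma x}\,dx}{\frac{\Phi(\gamma)}{\phi(\gamma)}+\int_0^\eta e^{-\gamma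 x}\,dx}.$$ *)

theory Defs
  imports "HOL-Probability.Probability" "HOL-Library.Landau_Symbols"
begin

(* The breakpoints lie in the interior of A, so f is smooth up to every endpoint of A in the
   one-sided sense given by "at x within A". D k is the k-th derivative of f; its values at the
   breakpoints are irrelevant for k > 0. Bounded derivatives of all orders on the open pieces
   make each piece smooth up to the breakpoints as well. *)
definition piecewise_smooth_on :: "real set \<Rightarrow> (real \<Rightarrow> real) \<Rightarrow> bool" where
  "piecewise_smooth_on A f \<longleftrightarrow>
     (\<exists>S D. finite S \<and> S \<subseteq> interior A \<and>
        (\<forall>x\<in>A. D (0::nat) x = f x) \<and>
        (\<forall>k. \<forall>x\<in>A - S. (D k has_real_derivative D (Suc k) x) (at x within A)) \<and>
        (\<forall>k\<ge>1. bounded (D k ` (A - S))))"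

definition revenue_profile :: "(real \<Rightarrow> real) \<Rightarrow> bool" where
  "revenue_profile r \<longleftrightarrow>
     range r \<subseteq> {0..1} \<and> continuous_on UNIV r \<and> r 0 = 1 \<and>
     piecewise_smooth_on {..0} r \<and> piecewise_smooth_on {0..} r \<and>
     mono_on {..0} r \<and> antimono_on {0..} r \<and>
     strict_antimono_on {x. x \<ge> 0 \<and> r x > 0} r \<and>
     (r \<longlongrightarrow> 0) at_top"

definition std_normal_cdf :: "real \<Rightarrow> real" where
  "std_normal_cdf = cdf std_normal_distribution"

definition R_T :: "(real \<Rightarrow> real) \<Rightarrow> real \<Rightarrow> real \<Rightarrow> real" where
  "R_T r \<gamma> \<eta> =
     ((LBINT x:{..0}. r x * exp (- x\<^sup>2 / 2 - \<gamma> * x)) + (LBINT x:{0..\<eta>}. r x * exp (- \<gamma> * x))) /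
     (std_normal_cdf \<gamma> / std_normal_density \<gamma> + (LBINT x:{0..\<eta>}. exp (- \<gamma> * x)))"

definition threshold_solution :: "(real \<Rightarrow> real) \<Rightarrow> real \<Rightarrow> real \<Rightarrow> bool" where
  "threshold_solution r \<gamma> \<eta> \<longleftrightarrow> \<eta> \<ge> 0 \<and> r \<eta> = R_T r \<gamma> \<eta>"

definition eta_opt :: "(real \<Rightarrow> real) \<Rightarrow> real \<Rightarrow> real" where
  "eta_opt r \<gamma> = (THE \<eta>. threshold_solution r \<gamma> \<eta>)"

end

theory Submission imports Defs begin

text \<open>
  By \<open>mills_ratio_eq_integral\<close>, the ratio \<open>R_T\<close> is the average of \<open>r\<close> over \<open>{..\<eta>}\<close> with
  respect to a positive weight: \<open>exp (- x\<^sup>2 / 2 - \<gamma> * x)\<close> on the left half-line and \<open>exp (- \<gamma> * x)\<close> on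
  the right. Clearing the denominator, the threshold equation says that the \<open>threshold_gap\<close>, the
  weighted integral of \<open>r x - r \<eta>\<close> over \<open>x \<le> \<eta>\<close>, vanishes. As \<open>\<eta>\<close> grows, the subtracted level drops,
  so the gap is nondecreasing; it starts nonpositive, is eventually nonnegative because \<open>r\<close> tends
  to \<open>0\<close>, and is strictly increasing where \<open>r > 0\<close>. This yields exactly one root
  (\<open>threshold_solution_ex1\<close>).

  For the asymptotics put \<open>\<gamma> = - g\<close> with \<open>g\<close> large. The weight \<open>exp (g * x)\<close> concentrates the left
  part at distance \<open>1 / g\<close> from the cusp, where \<open>r\<close> may be replaced by its one-sided linear
  approximations with quadratic error. At \<open>\<eta> = t / g\<close> this gives
  (\<open>rescaled_threshold_gap\<close>), uniformly for \<open>t\<close> in a bounded interval,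
  \<open>g\<^sup>2 * threshold_gap r (- g) (t / g) = - rR' * (exp t - 1) - rL' + O(1 / g)\<close>.
  The leading part has a simple zero at \<open>t0 = ln (1 - rL' / rR')\<close>, positive because of the cusp.
  Since the gap is monotone, its sign at \<open>t = t0 \<plusminus> K / g\<close> traps the root in between; in terms of
  \<open>\<eta> = t / g\<close> this is the claimed expansion (\<open>threshold_solution_near\<close>).
\<close>

section \<open>The Gaussian weight on the left half-line\<close>

lemma integrable_gaussian_tilt:
  "integrable lborel (\<lambda>x::real. exp (- x\<^sup>2 / 2 - \<gamma> * x))"
proof -
  have "integrable lborel (\<lambda>x. sqrt (2 * pi) * exp (\<gamma>\<^sup>2 / 2) * normal_density (- \<gamma>) 1 x)"
    by (intro integrable_mult_right integrable_normal_density) simp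
  also have "(\<lambda>x. sqrt (2 * pi) * exp (\<gamma>\<^sup>2 / 2) * normal_density (- \<gamma>) 1 x) =
      (\<lambda>x. exp (- x\<^sup>2 / 2 - \<gamma> * x))"
    by (auto simp: normal_density_def fun_eq_iff exp_add[symmetric] power2_eq_square field_simps)
  finally show ?thesis .
qed

text \<open>
  Completing the square turns the Mills-type ratio \<open>\<Phi>(\<gamma>) / \<phi>(\<gamma>)\<close> into the mass of the same
  weight that appears in the left part of the numerator of \<open>R_T\<close>. Numerator and
  denominator thus integrate \<open>r\<close> and \<open>1\<close> against one common positive weight.
\<close>
lemma mills_ratio_eq_integral:
  "std_normal_cdf \<gamma> / std_normal_density \<gamma> = (LBINT x:{..0}. exp (- x\<^sup>2 / 2 - \<gamma> * x))"
proof -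
  have "std_normal_cdf \<gamma> = (\<integral>x. indicator {..\<gamma>} x \<partial>std_normal_distribution)"
    by (simp add: std_normal_cdf_def cdf_def)
  also have "\<dots> = (\<integral>x. std_normal_density x *\<^sub>R indicator {..\<gamma>} x \<partial>lborel)"
    by (subst integral_density) auto
  also have "\<dots> = (\<integral>x. std_normal_density (\<gamma> + x) *\<^sub>R indicator {..\<gamma>} (\<gamma> + x) \<partial>lborel)"
    by (subst lborel_integral_real_affine[where c = 1 and t = \<gamma>]) auto
  also have "\<dots> = (\<integral>x. std_normal_density \<gamma> * (indicator {..0} x * exp (- x\<^sup>2 / 2 - \<gamma> * x)) \<partial>lborel)"
    by (intro Bochner_Integration.integral_cong)
      (auto simp: std_normal_density_def indicator_def exp_add[symmetric] power2_eq_square field_simps)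
  finally have "std_normal_cdf \<gamma> =
      std_normal_density \<gamma> * (LBINT x:{..0}. exp (- x\<^sup>2 / 2 - \<gamma> * x))"
    by (simp add: set_lebesgue_integral_def)
  moreover have "std_normal_density \<gamma> > 0" by (simp add: normal_density_pos)
  ultimately show ?thesis by (simp add: field_simps)
qed

lemma set_integrable_gaussian_tilt:
  fixes f :: "real \<Rightarrow> real"
  assumes "f \<in> borel_measurable borel" "\<And>x. x \<le> 0 \<Longrightarrow> \<bar>f x\<bar> \<le> B"
  shows "set_integrable lborel {..0} (\<lambda>x. f x * exp (- x\<^sup>2 / 2 - \<gamma> * x))"
  unfolding set_integrable_def
proof (rule Bochner_Integration.integrable_bound)
  show "integrable lborel (\<lambda>x. B * exp (- x\<^sup>2 / 2 - \<gamma> * x))"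
    by (intro integrable_mult_right integrable_gaussian_tilt)
  have "0 \<le> B" using assms(2)[of 0] by linarith
  show "AE x in lborel. norm (indicat_real {..0} x *\<^sub>R (f x * exp (- x\<^sup>2 / 2 - \<gamma> * x)))
      \<le> norm (B * exp (- x\<^sup>2 / 2 - \<gamma> * x))"
    using assms(2) \<open>0 \<le> B\<close> by (intro always_eventually) (auto simp: indicator_def abs_mult)
  show "(\<lambda>x. indicat_real {..0} x *\<^sub>R (f x * exp (- x\<^sup>2 / 2 - \<gamma> * x))) \<in> borel_measurable lborel"
    using assms(1) by measurable
qed

text \<open>
  Positivity of an integral needs strict positivity of the integrand only on some nondegenerate
  compact interval, where continuity provides a positive lower bound.
\<close>
lemma set_integral_pos:
  fixes f :: "real \<Rightarrow> real"
  assumes "a < b" "{a..b} \<subseteq> A" "continuous_on {a..b} f"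
    and "set_integrable lborel A f"
    and "\<And>x. x \<in> A \<Longrightarrow> 0 \<le> f x" "\<And>x. x \<in> {a..b} \<Longrightarrow> 0 < f x"
  shows "0 < (LBINT x:A. f x)"
proof -
  obtain z where z: "z \<in> {a..b}" "\<And>x. x \<in> {a..b} \<Longrightarrow> f z \<le> f x"
    using continuous_attains_inf[of "{a..b}" f] assms(1,3) by auto
  have "0 < f z * (b - a)" using assms(1,6) z(1) by simp
  also have "\<dots> = (LBINT x:{a..b}. f z)"
    using assms(1) by (simp add: set_lebesgue_integral_def)
  also have "\<dots> = (\<integral>x. indicator {a..b} x *\<^sub>R f z \<partial>lborel)"
    by (simp add: set_lebesgue_integral_def)
  also have "\<dots> \<le> (\<integral>x. indicator A x *\<^sub>R f x \<partial>lborel)"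
  proof (rule integral_mono)
    show "integrable lborel (\<lambda>x. indicator {a..b} x *\<^sub>R f z)"
      by (intro integrable_scaleR_left impI integrable_real_indicator) (auto simp: emeasure_lborel_Icc_eq)
    show "integrable lborel (\<lambda>x. indicator A x *\<^sub>R f x)"
      using assms(4) by (simp add: set_integrable_def)
    show "indicator {a..b} x *\<^sub>R f z \<le> indicator A x *\<^sub>R f x" for x
      using z(2) assms(2,5) by (auto simp: indicator_def)
  qed
  finally show ?thesis by (simp add: set_lebesgue_integral_def)
qed

section \<open>The threshold equation as a monotone root problem\<close>

text \<open>
  Denominator and numerator of \<open>R_T\<close>, as integrals against the common weight.
\<close>
definition weight_mass :: "real \<Rightarrow> real \<Rightarrow> real" where
  "weight_mass \<gamma> \<eta> = (LBINT x:{..0}. exp (- x\<^sup>2 / 2 - \<gamma> * x)) + (LBINT x:{0..\<eta>}. exp (- \<gamma> * x))"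

definition revenue_mass :: "(real \<Rightarrow> real) \<Rightarrow> real \<Rightarrow> real \<Rightarrow> real" where
  "revenue_mass r \<gamma> \<eta> =
     (LBINT x:{..0}. r x * exp (- x\<^sup>2 / 2 - \<gamma> * x)) + (LBINT x:{0..\<eta>}. r x * exp (- \<gamma> * x))"

text \<open>
  The threshold equation with the denominator cleared. It is the integral of \<open>r x - r \<eta>\<close> against
  the common weight over \<open>x \<le> \<eta>\<close>, see \<open>threshold_gap_eq_integrals\<close> below; its sign tells on
  which side of the threshold \<open>\<eta>\<close> lies.
\<close>
definition threshold_gap :: "(real \<Rightarrow> real) \<Rightarrow> real \<Rightarrow> real \<Rightarrow> real" where
  "threshold_gap r \<gamma> \<eta> = revenue_mass r \<gamma> \<eta> - r \<eta> * weight_mass \<gamma> \<eta>"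

lemma R_T_eq: "R_T r \<gamma> \<eta> = revenue_mass r \<gamma> \<eta> / weight_mass \<gamma> \<eta>"
  by (simp add: R_T_def revenue_mass_def weight_mass_def mills_ratio_eq_integral)

lemma revenue_profileD:
  assumes "revenue_profile r"
  shows "0 \<le> r x" "r x \<le> 1" "continuous_on A r" "r 0 = 1"
    "r \<in> borel_measurable borel"
    "\<And>x y. 0 \<le> x \<Longrightarrow> x \<le> y \<Longrightarrow> r y \<le> r x"
    "\<And>x y. 0 \<le> x \<Longrightarrow> x < y \<Longrightarrow> 0 < r y \<Longrightarrow> r y < r x"
    "(r \<longlongrightarrow> 0) at_top"
proof -
  have "range r \<subseteq> {0..1}" using assms by (simp add: revenue_profile_def)
  then have rng: "r x \<in> {0..1}" for x by blast
  then show "0 \<le> r x" "r x \<le> 1" by auto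
  show "continuous_on A r"
    using assms continuous_on_subset unfolding revenue_profile_def by blast
  show "r 0 = 1" "(r \<longlongrightarrow> 0) at_top" using assms by (auto simp: revenue_profile_def)
  show "r \<in> borel_measurable borel"
    using assms borel_measurable_continuous_onI unfolding revenue_profile_def by blast
  show mono: "r y \<le> r x" if "0 \<le> x" "x \<le> y" for x y
  proof -
    have "antimono_on {0..} r" using assms by (simp add: revenue_profile_def)
    from monotone_onD[OF this, of x y] show ?thesis using that by auto
  qed
  show "r y < r x" if "0 \<le> x" "x < y" "0 < r y" for x y
  proof -
    have "strict_antimono_on {x. x \<ge> 0 \<and> r x > 0} r" using assms by (simp add: revenue_profile_def)
    from monotone_onD[OF this, of x y] show ?thesis using that mono[of x y] by auto
  qed
qed

lemma set_integrable_revenue: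
  assumes "revenue_profile r"
  shows "set_integrable lborel {..0} (\<lambda>x. r x * exp (- x\<^sup>2 / 2 - \<gamma> * x))"
    "set_integrable lborel {a..b} (\<lambda>x. r x * exp (- \<gamma> * x))"
proof -
  show "set_integrable lborel {..0} (\<lambda>x. r x * exp (- x\<^sup>2 / 2 - \<gamma> * x))"
    using revenue_profileD(1,2,5)[OF assms]
    by (intro set_integrable_gaussian_tilt[where B = 1]) auto
  show "set_integrable lborel {a..b} (\<lambda>x. r x * exp (- \<gamma> * x))"
    by (intro borel_integrable_atLeastAtMost' continuous_intros revenue_profileD[OF assms])
qed

lemma set_integrable_weight:
  fixes \<gamma> :: real
  shows "set_integrable lborel {..0::real} (\<lambda>x. exp (- x\<^sup>2 / 2 - \<gamma> * x))"
    "set_integrable lborel {a..b} (\<lambda>x. exp (- \<gamma> * x))"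
  using set_integrable_gaussian_tilt[of "\<lambda>_. 1" 1 \<gamma>]
  by (auto intro!: borel_integrable_atLeastAtMost' continuous_intros)

lemma left_revenue_pos:
  assumes "revenue_profile r"
  shows "0 < (LBINT x:{..0}. r x * exp (- x\<^sup>2 / 2 - \<gamma> * x))"
proof -
  note rp = revenue_profileD[OF assms]
  have "isCont r 0" using rp(3)[of UNIV] by (simp add: continuous_on_eq_continuous_at)
  then obtain d where d: "d > 0" "\<And>x. \<bar>x\<bar> < d \<Longrightarrow> \<bar>r x - r 0\<bar> < 1"
    using continuous_at_eps_delta[of 0 r]
    by (metis diff_0_right dist_real_def real_norm_def zero_less_one)
  have pos: "r x > 0" if "- d / 2 \<le> x" "x \<le> 0" for x
    using d(2)[of x] d(1) that rp(4) by linarith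
  show ?thesis
    using d(1) rp(1) pos
    by (intro set_integral_pos[where a = "- d / 2" and b = 0] continuous_intros rp(3)
        set_integrable_revenue[OF assms]) auto
qed

text \<open>
  On \<open>{\<eta>1..\<eta>2}\<close> the profile is at least its value at the right end, so every additional unit of
  weight contributes at least \<open>r \<eta>2\<close> to the revenue.
\<close>
lemma masses_increment:
  assumes "revenue_profile r" "0 \<le> \<eta>1" "\<eta>1 \<le> \<eta>2"
  shows "r \<eta>2 * (weight_mass \<gamma> \<eta>2 - weight_mass \<gamma> \<eta>1)
      \<le> revenue_mass r \<gamma> \<eta>2 - revenue_mass r \<gamma> \<eta>1"
proof -
  note rp = revenue_profileD[OF assms(1)]
  have split: "(LBINT x:{0..\<eta>2}. f x) - (LBINT x:{0..\<eta>1}. f x) = (LBINT x:{\<eta>1..\<eta>2}. f x)"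
    if "continuous_on {0..\<eta>2} f" for f :: "real \<Rightarrow> real"
  proof -
    have c: "continuous_on {0..\<eta>1} f" "continuous_on {\<eta>1..\<eta>2} f"
      by (rule continuous_on_subset[OF that]; use assms(2,3) in auto)+
    have "(LBINT x:{0..\<eta>2}. f x) = integral {0..\<eta>2} f"
      "(LBINT x:{0..\<eta>1}. f x) = integral {0..\<eta>1} f"
      "(LBINT x:{\<eta>1..\<eta>2}. f x) = integral {\<eta>1..\<eta>2} f"
      by (intro set_borel_integral_eq_integral(2) borel_integrable_atLeastAtMost' that c)+
    then show ?thesis
      using Henstock_Kurzweil_Integration.integral_combine[OF assms(2,3)
          integrable_continuous_real[OF that]] by simp
  qed
  have "r \<eta>2 * (weight_mass \<gamma> \<eta>2 - weight_mass \<gamma> \<eta>1) = (LBINT x:{\<eta>1..\<eta>2}. r \<eta>2 * exp (- \<gamma> * x))"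
    by (simp add: weight_mass_def split[symmetric] continuous_intros)
  also have "\<dots> \<le> (LBINT x:{\<eta>1..\<eta>2}. r x * exp (- \<gamma> * x))"
    using assms(2) by (intro set_integral_mono set_integrable_revenue[OF assms(1)]
        set_integrable_mult_right set_integrable_weight) (auto intro!: mult_right_mono rp(6))
  also have "\<dots> = revenue_mass r \<gamma> \<eta>2 - revenue_mass r \<gamma> \<eta>1"
    by (simp add: revenue_mass_def split[symmetric] continuous_intros rp(3))
  finally show ?thesis .
qed

lemma revenue_mass_le_weight_mass:
  assumes "revenue_profile r"
  shows "revenue_mass r \<gamma> \<eta> \<le> weight_mass \<gamma> \<eta>"
  unfolding revenue_mass_def weight_mass_def
  by (intro add_mono set_integral_mono set_integrable_revenue[OF assms] set_integrable_weight)
    (auto simp: revenue_profileD[OF assms] mult_le_cancel_right1)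

lemma revenue_mass_pos:
  assumes "revenue_profile r"
  shows "0 < revenue_mass r \<gamma> \<eta>"
proof -
  have "0 \<le> (LBINT x:{0..\<eta>}. r x * exp (- \<gamma> * x))"
    unfolding set_lebesgue_integral_def
    by (intro Bochner_Integration.integral_nonneg) (simp add: revenue_profileD[OF assms])
  then show ?thesis
    unfolding revenue_mass_def using left_revenue_pos[OF assms, of \<gamma>] by linarith
qed

lemma weight_mass_pos:
  assumes "revenue_profile r"
  shows "0 < weight_mass \<gamma> \<eta>"
  using revenue_mass_pos[OF assms] revenue_mass_le_weight_mass[OF assms] by (rule less_le_trans)

lemma threshold_solution_iff_gap:
  assumes "revenue_profile r"
  shows "threshold_solution r \<gamma> \<eta> \<longleftrightarrow> 0 \<le> \<eta> \<and> threshold_gap r \<gamma> \<eta> = 0"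
  using weight_mass_pos[OF assms, of \<gamma> \<eta>]
  by (auto simp: threshold_solution_def threshold_gap_def R_T_eq field_simps)

text \<open>
  The gap grows because the level \<open>r \<eta>\<close> that is subtracted drops on the mass already collected.
  This gives monotonicity, and strictness wherever \<open>r\<close> drops strictly.
\<close>
lemma threshold_gap_increment:
  assumes "revenue_profile r" "0 \<le> \<eta>1" "\<eta>1 \<le> \<eta>2"
  shows "(r \<eta>1 - r \<eta>2) * weight_mass \<gamma> \<eta>1 \<le> threshold_gap r \<gamma> \<eta>2 - threshold_gap r \<gamma> \<eta>1"
  using masses_increment[OF assms, of \<gamma>] unfolding threshold_gap_def by (simp add: algebra_simps)

lemma threshold_gap_mono:
  assumes "revenue_profile r" "0 \<le> \<eta>1" "\<eta>1 \<le> \<eta>2"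
  shows "threshold_gap r \<gamma> \<eta>1 \<le> threshold_gap r \<gamma> \<eta>2"
proof -
  have "0 \<le> (r \<eta>1 - r \<eta>2) * weight_mass \<gamma> \<eta>1"
    using revenue_profileD(6)[OF assms] weight_mass_pos[OF assms(1), of \<gamma> \<eta>1] by simp
  then show ?thesis using threshold_gap_increment[OF assms, of \<gamma>] by linarith
qed

text \<open>
  At a root \<open>r \<eta>\<close> is a ratio of positive masses, hence positive. Two roots would therefore both
  lie in the region where \<open>r\<close> is strictly decreasing, and there the gap is strictly increasing.
\<close>
lemma threshold_gap_root_unique:
  assumes r: "revenue_profile r"
    and "0 \<le> \<eta>1" "threshold_gap r \<gamma> \<eta>1 = 0" "0 \<le> \<eta>2" "threshold_gap r \<gamma> \<eta>2 = 0"
  shows "\<eta>1 = \<eta>2"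
proof -
  have no_two: False if "0 \<le> a" "a < b" "threshold_gap r \<gamma> a = 0" "threshold_gap r \<gamma> b = 0" for a b
  proof -
    have "0 < r b * weight_mass \<gamma> b"
      using revenue_mass_pos[OF r, of \<gamma> b] that(4) by (simp add: threshold_gap_def)
    then have "0 < r b"
      using weight_mass_pos[OF r, of \<gamma> b] by (simp add: zero_less_mult_iff)
    then have "r b < r a" using revenue_profileD(7)[OF r that(1,2)] by simp
    then have "0 < (r a - r b) * weight_mass \<gamma> a" using weight_mass_pos[OF r] by simp
    also have "\<dots> \<le> 0"
      using threshold_gap_increment[OF r that(1), of b \<gamma>] that(2-4) by simp
    finally show False by simp
  qed
  show ?thesis using no_two[of \<eta>1 \<eta>2] no_two[of \<eta>2 \<eta>1] assms by (cases \<eta>1 \<eta>2 rule: linorder_cases) auto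
qed

lemma threshold_gap_eq_integrals:
  assumes "revenue_profile r"
  shows "threshold_gap r \<gamma> \<eta> =
    (LBINT x:{..0}. (r x - r \<eta>) * exp (- x\<^sup>2 / 2 - \<gamma> * x)) + (LBINT x:{0..\<eta>}. (r x - r \<eta>) * exp (- \<gamma> * x))"
proof -
  have "(LBINT x:{..0}. (r x - r \<eta>) * exp (- x\<^sup>2 / 2 - \<gamma> * x)) =
      (LBINT x:{..0}. r x * exp (- x\<^sup>2 / 2 - \<gamma> * x)) - r \<eta> * (LBINT x:{..0}. exp (- x\<^sup>2 / 2 - \<gamma> * x))"
    unfolding left_diff_distrib
    by (subst set_integral_diff)
      (use set_integrable_revenue[OF assms] set_integrable_weight in \<open>auto\<close>)
  moreover have "(LBINT x:{0..\<eta>}. (r x - r \<eta>) * exp (- \<gamma> * x)) =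
      (LBINT x:{0..\<eta>}. r x * exp (- \<gamma> * x)) - r \<eta> * (LBINT x:{0..\<eta>}. exp (- \<gamma> * x))"
    unfolding left_diff_distrib
    by (subst set_integral_diff) (use set_integrable_revenue[OF assms] set_integrable_weight in \<open>auto\<close>)
  ultimately show ?thesis
    by (simp add: threshold_gap_def revenue_mass_def weight_mass_def algebra_simps)
qed

lemma threshold_gap_continuous:
  assumes "revenue_profile r"
  shows "continuous_on {0..b} (threshold_gap r \<gamma>)"
proof -
  have cont: "continuous_on {0..b} (\<lambda>\<eta>. LBINT x:{0..\<eta>}. f x)" if "continuous_on UNIV f" for f :: "real \<Rightarrow> real"
  proof -
    have c: "continuous_on A f" for A using that continuous_on_subset by blast
    have "(\<lambda>\<eta>. LBINT x:{0..\<eta>}. f x) = (\<lambda>\<eta>. integral {0..\<eta>} f)"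
      by (intro ext set_borel_integral_eq_integral(2) borel_integrable_atLeastAtMost' c)
    then show ?thesis
      by (simp only:) (intro indefinite_integral_continuous_1 integrable_continuous_real c)
  qed
  show ?thesis
    unfolding threshold_gap_def[abs_def] revenue_mass_def weight_mass_def
    by (intro continuous_intros cont revenue_profileD[OF assms])
qed

text \<open>
  At \<open>\<eta> = 0\<close> the gap is nonpositive because \<open>r \<le> 1 = r 0\<close>. For large \<open>\<eta>\<close> the level \<open>r \<eta>\<close> is
  smaller than the ratio of revenue to weight collected on the left half-line alone, so the gap is
  nonnegative there; the intermediate value theorem applies.
\<close>
lemma threshold_gap_root_exists:
  assumes "revenue_profile r"
  shows "\<exists>\<eta>\<ge>0. threshold_gap r \<gamma> \<eta> = 0"
proof -
  note rp = revenue_profileD[OF assms]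
  define N G where "N = revenue_mass r \<gamma> 0" and "G = weight_mass \<gamma> 0"
  have pos: "0 < N" "0 < G"
    using revenue_mass_pos[OF assms] weight_mass_pos[OF assms] by (auto simp: N_def G_def)
  have "\<forall>\<^sub>F x in at_top. r x < N / G"
    using rp(8) pos by (intro order_tendstoD) auto
  then have "\<forall>\<^sub>F x in at_top. r x < N / G \<and> 0 \<le> x"
    using eventually_ge_at_top[of 0] by eventually_elim auto
  then obtain b where b: "r b < N / G" "0 \<le> b"
    by (auto simp: eventually_at_top_linorder)
  have "r b * G < N" using b(1) pos(2) by (simp add: field_simps)
  with masses_increment[OF assms order_refl b(2), of \<gamma>] have "0 \<le> threshold_gap r \<gamma> b"
    by (simp add: threshold_gap_def N_def G_def algebra_simps)
  moreover have "threshold_gap r \<gamma> 0 \<le> 0"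
    using revenue_mass_le_weight_mass[OF assms] by (simp add: threshold_gap_def rp(4))
  ultimately show ?thesis
    using IVT'[of "threshold_gap r \<gamma>" 0 0 b] b(2) threshold_gap_continuous[OF assms] by auto
qed

lemma threshold_solution_ex1:
  assumes "revenue_profile r"
  shows "\<exists>!\<eta>. threshold_solution r \<gamma> \<eta>"
  using threshold_gap_root_exists[OF assms] threshold_gap_root_unique[OF assms]
  unfolding threshold_solution_iff_gap[OF assms] by blast

section \<open>Quadratic remainders of one-sided linear approximations\<close>

text \<open>
  Breakpoints are interior, so the boundary point \<open>0\<close> is not one of them. Near \<open>0\<close> the
  first derivative is therefore Lipschitz, with the bound of the second derivative as constant, and
  integrating once more gives the quadratic remainder. The mean value inequality is used twice.
\<close>
lemma piecewise_smooth_quadratic_remainder_local: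
  assumes pw: "piecewise_smooth_on A f" and A: "convex A" "0 \<in> A" "0 \<notin> interior A"
    and deriv: "(f has_real_derivative f') (at 0 within A)"
    and nontriv: "at 0 within A \<noteq> bot"
  obtains \<delta> B where "0 < \<delta>" "\<And>x. x \<in> A \<Longrightarrow> \<bar>x\<bar> < \<delta> \<Longrightarrow> \<bar>f x - (f 0 + f' * x)\<bar> \<le> B * x\<^sup>2"
proof -
  obtain S D where S: "finite S" "S \<subseteq> interior A" and D0: "\<And>x. x \<in> A \<Longrightarrow> D (0::nat) x = f x"
    and D: "\<And>k x. x \<in> A - S \<Longrightarrow> (D k has_real_derivative D (Suc k) x) (at x within A)"
    and bdd: "\<And>k. k \<ge> 1 \<Longrightarrow> bounded (D k ` (A - S))"
    using pw unfolding piecewise_smooth_on_def by blast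
  have "open (- S)" "0 \<in> - S" using S A(3) by (auto simp: finite_imp_closed)
  then obtain \<delta> where \<delta>: "0 < \<delta>" "ball 0 \<delta> \<subseteq> - S"
    by (auto elim: openE)
  obtain B where B: "\<And>x. x \<in> A - S \<Longrightarrow> \<bar>D 2 x\<bar> \<le> B"
    using bdd[of 2] by (auto simp: bounded_iff)
  define T where "T = A \<inter> ball 0 \<delta>"
  have T: "convex T" "T \<subseteq> A - S" "0 \<in> T"
    using A \<delta> by (auto simp: T_def intro!: convex_Int)
  have D_T: "(D k has_real_derivative D (Suc k) x) (at x within T)" if "x \<in> T" for k x
    using D[of x k] T(2) that by (blast intro: DERIV_subset)
  have D0': "(D 0 has_real_derivative f') (at 0 within A)"
    using deriv D0 A(2) by (subst has_field_derivative_cong_eventually[where g = f])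
      (auto simp: eventually_at_filter)
  have D1: "D (Suc 0) 0 = f'"
    using D[of 0 0] D0' nontriv T(2,3) has_field_derivative_unique by blast
  have B1: "\<bar>D (Suc 0) x - f'\<bar> \<le> B * \<bar>x\<bar>" if "x \<in> T" for x
    using field_differentiable_bound[OF T(1) D_T[of _ "Suc 0"], of B x 0] B T that
    by (auto simp: D1 numeral_2_eq_2)
  show thesis
  proof (rule that)
    show "0 < \<delta>" by fact
    fix x assume x: "x \<in> A" "\<bar>x\<bar> < \<delta>"
    (* On this smaller convex set the Lipschitz bound on the derivative is uniform in terms of x. *)
    define U where "U = T \<inter> cball 0 \<bar>x\<bar>"
    have U: "convex U" "U \<subseteq> T" "x \<in> U" "0 \<in> U" "\<And>y. y \<in> U \<Longrightarrow> \<bar>y\<bar> \<le> \<bar>x\<bar>"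
      using x T by (auto simp: U_def T_def intro!: convex_Int)
    have "0 \<le> B" using B[of 0] T by force
    have "norm ((D 0 x - f' * x) - (D 0 0 - f' * 0)) \<le> (B * \<bar>x\<bar>) * norm (x - 0)"
    proof (rule field_differentiable_bound[OF U(1)])
      show "((\<lambda>y. D 0 y - f' * y) has_real_derivative D (Suc 0) y - f') (at y within U)"
        if "y \<in> U" for y
        using U(2) that by (auto intro!: derivative_eq_intros DERIV_subset[OF D_T])
      show "norm (D (Suc 0) y - f') \<le> B * \<bar>x\<bar>" if "y \<in> U" for y
        using B1[of y] U(2) U(5)[OF that] that \<open>0 \<le> B\<close>
        by (auto intro: order_trans[OF _ mult_left_mono])
    qed (use U in auto)
    then show "\<bar>f x - (f 0 + f' * x)\<bar> \<le> B * x\<^sup>2"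
      using D0 x(1) A(2) by (simp add: power2_eq_square abs_mult[symmetric] algebra_simps)
  qed
qed

text \<open>
  For a bounded function the remainder bound extends to the whole domain: away from \<open>0\<close>
  constants and linear terms are dominated by a multiple of \<open>x\<^sup>2\<close>. With a global bound no
  tail of an integral has to be cut off later.
\<close>
lemma piecewise_smooth_quadratic_remainder:
  assumes "piecewise_smooth_on A f" "convex A" "0 \<in> A" "0 \<notin> interior A"
    and "(f has_real_derivative f') (at 0 within A)" "at 0 within A \<noteq> bot"
    and bdd: "\<And>x. x \<in> A \<Longrightarrow> \<bar>f x - f 0\<bar> \<le> M"
  obtains C where "0 \<le> C" "\<And>x. x \<in> A \<Longrightarrow> \<bar>f x - (f 0 + f' * x)\<bar> \<le> C * x\<^sup>2"
proof -
  obtain \<delta> B where \<delta>: "0 < \<delta>"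
    and B: "\<And>x. x \<in> A \<Longrightarrow> \<bar>x\<bar> < \<delta> \<Longrightarrow> \<bar>f x - (f 0 + f' * x)\<bar> \<le> B * x\<^sup>2"
    using piecewise_smooth_quadratic_remainder_local[OF assms(1-6)] by blast
  have "0 \<le> M" using bdd[OF assms(3)] by simp
  define C where "C = max 0 B + M / \<delta>\<^sup>2 + \<bar>f'\<bar> / \<delta>"
  show thesis
  proof (rule that)
    show "0 \<le> C" using \<open>0 \<le> M\<close> \<delta> by (simp add: C_def)
    fix x assume x: "x \<in> A"
    show "\<bar>f x - (f 0 + f' * x)\<bar> \<le> C * x\<^sup>2"
    proof (cases "\<bar>x\<bar> < \<delta>")
      case True
      have "B \<le> C" using \<open>0 \<le> M\<close> \<delta> by (simp add: C_def add_increasing2)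
      then have "B * x\<^sup>2 \<le> C * x\<^sup>2" by (intro mult_right_mono) auto
      then show ?thesis using B[OF x True] by linarith
    next
      case False
      have "1 \<le> \<bar>x\<bar> / \<delta>" using False \<delta> by simp
      moreover from this have "1 \<le> (\<bar>x\<bar> / \<delta>)\<^sup>2" by (rule one_le_power)
      ultimately have "M * 1 + (\<bar>f'\<bar> * \<bar>x\<bar>) * 1 \<le>
          M * (\<bar>x\<bar> / \<delta>)\<^sup>2 + (\<bar>f'\<bar> * \<bar>x\<bar>) * (\<bar>x\<bar> / \<delta>)"
        using \<open>0 \<le> M\<close> by (intro add_mono mult_left_mono) auto
      then have "M + \<bar>f' * x\<bar> \<le> (M / \<delta>\<^sup>2 + \<bar>f'\<bar> / \<delta>) * x\<^sup>2"
        by (simp add: power2_eq_square abs_mult field_simps)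
      also have "\<dots> \<le> C * x\<^sup>2" unfolding C_def by (intro mult_right_mono) auto
      finally show ?thesis using bdd[OF x] by linarith
    qed
  qed
qed

section \<open>Exponential integrals of nearly linear functions\<close>

text \<open>
  Up to reflection and a factor \<open>g\<close>, this is a moment of the exponential distribution.
\<close>
lemma laplace_monomial:
  fixes g :: real
  assumes "0 < g"
  shows "has_bochner_integral lborel (\<lambda>x. indicator {..0} x * (\<bar>x\<bar> ^ k * exp (g * x)))
    (fact k / g ^ Suc k)"
proof -
  have "has_bochner_integral lborel (\<lambda>x. erlang_density 0 g x * x ^ k) (fact k / g ^ k)"
    using nn_integral_erlang_ith_moment[OF assms, of 0 k] assms
    by (intro has_bochner_integral_nn_integral) (auto simp: erlang_density_def)
  then have "has_bochner_integral lborel (\<lambda>x. (1 / g) * (erlang_density 0 g x * x ^ k)) ((1 / g) * (fact k / g ^ k))"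
    by (rule has_bochner_integral_mult_right)
  then have "has_bochner_integral lborel (\<lambda>x. (1 / g) * (erlang_density 0 g (0 + (- 1) * x) * (0 + (- 1) * x) ^ k)) (fact k / g ^ Suc k)"
    using assms lborel_has_bochner_integral_real_affine_iff[where c = "- 1" and t = 0, THEN iffD1]
    by (fastforce simp: field_simps)
  also have "(\<lambda>x. (1 / g) * (erlang_density 0 g (0 + (- 1) * x) * (0 + (- 1) * x) ^ k)) =
      (\<lambda>x. indicator {..0} x * (\<bar>x\<bar> ^ k * exp (g * x)))"
    using assms by (auto simp: fun_eq_iff erlang_density_def indicator_def)
  finally show ?thesis .
qed

text \<open>
  A quantitative form of Watson's lemma to second order. Since \<open>u\<close> differs from its linear
  approximation by at most \<open>C * x\<^sup>2\<close> on the whole half-line, the error is bounded by the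
  second moment of the exponential weight.
\<close>
lemma laplace_linear_approx:
  fixes u :: "real \<Rightarrow> real" and g :: real
  assumes g: "0 < g" and int: "set_integrable lborel {..0} (\<lambda>x. u x * exp (g * x))"
    and approx: "\<And>x. x \<le> 0 \<Longrightarrow> \<bar>u x - (p + q * x)\<bar> \<le> C * x\<^sup>2"
  shows "\<bar>(LBINT x:{..0}. u x * exp (g * x)) - (p / g - q / g\<^sup>2)\<bar> \<le> 2 * C / g ^ 3"
proof -
  note L = laplace_monomial[OF g]
  have lin: "has_bochner_integral lborel (\<lambda>x. indicator {..0} x * ((p + q * x) * exp (g * x))) (p / g - q / g\<^sup>2)"
  proof -
    have "has_bochner_integral lborel (\<lambda>x. p * (indicator {..0} x * (\<bar>x\<bar> ^ 0 * exp (g * x))) -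
        q * (indicator {..0} x * (\<bar>x\<bar> ^ 1 * exp (g * x)))) (p * (fact 0 / g ^ Suc 0) - q * (fact 1 / g ^ Suc 1))"
      by (intro has_bochner_integral_diff has_bochner_integral_mult_right L)
    also have "(\<lambda>x. p * (indicator {..0} x * (\<bar>x\<bar> ^ 0 * exp (g * x))) -
        q * (indicator {..0} x * (\<bar>x\<bar> ^ 1 * exp (g * x)))) =
        (\<lambda>x. indicator {..0} x * ((p + q * x) * exp (g * x)))"
      by (auto simp: fun_eq_iff indicator_def algebra_simps)
    finally show ?thesis by (simp add: power2_eq_square)
  qed
  have quad: "has_bochner_integral lborel (\<lambda>x. C * (indicator {..0} x * (\<bar>x\<bar> ^ 2 * exp (g * x)))) (2 * C / g ^ 3)"
  proof -
    have "has_bochner_integral lborel (\<lambda>x. C * (indicator {..0} x * (\<bar>x\<bar> ^ 2 * exp (g * x)))) (C * (fact 2 / g ^ Suc 2))"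
      by (intro has_bochner_integral_mult_right L)
    then show ?thesis by (simp add: numeral_3_eq_3 numeral_2_eq_2 mult.commute)
  qed
  have int': "integrable lborel (\<lambda>x. indicator {..0} x * (u x * exp (g * x)))"
    using int by (simp add: set_integrable_def)
  have "\<bar>(LBINT x:{..0}. u x * exp (g * x)) - (p / g - q / g\<^sup>2)\<bar> =
      \<bar>\<integral>x. indicator {..0} x * (u x * exp (g * x)) - indicator {..0} x * ((p + q * x) * exp (g * x)) \<partial>lborel\<bar>"
    using lin int' by (simp add: set_lebesgue_integral_def has_bochner_integral_iff)
  also have "\<dots> \<le> (\<integral>x. C * (indicator {..0} x * (\<bar>x\<bar> ^ 2 * exp (g * x))) \<partial>lborel)"
  proof (rule integral_abs_bound_integral)
    fix x :: real
    have "\<bar>u x - (p + q * x)\<bar> * exp (g * x) \<le> C * x\<^sup>2 * exp (g * x)" if "x \<le> 0"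
      using approx[OF that] by (intro mult_right_mono) auto
    then show "\<bar>indicator {..0} x * (u x * exp (g * x)) - indicator {..0} x * ((p + q * x) * exp (g * x))\<bar>
        \<le> C * (indicator {..0} x * (\<bar>x\<bar> ^ 2 * exp (g * x)))"
      by (auto simp: indicator_def left_diff_distrib[symmetric] abs_mult)
  qed (use lin int' quad in \<open>auto simp: has_bochner_integral_iff\<close>)
  also have "\<dots> = 2 * C / g ^ 3" by (rule has_bochner_integral_integral_eq[OF quad])
  finally show ?thesis .
qed

lemma exp_linear_kernel_integral:
  fixes g :: real
  assumes "0 < g" "0 \<le> \<eta>"
  shows "(LBINT x:{0..\<eta>}. exp (g * x)) = (exp (g * \<eta>) - 1) / g"
    "(LBINT x:{0..\<eta>}. (\<eta> - x) * exp (g * x)) = (exp (g * \<eta>) - 1 - g * \<eta>) / g\<^sup>2"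
proof -
  have "(\<integral>x. exp (g * x) * indicator {0..\<eta>} x \<partial>lborel) = exp (g * \<eta>) / g - exp (g * 0) / g"
    using assms by (intro integral_FTC_Icc_real[where F = "\<lambda>x. exp (g * x) / g"])
      (auto intro!: derivative_eq_intros)
  then show "(LBINT x:{0..\<eta>}. exp (g * x)) = (exp (g * \<eta>) - 1) / g"
    by (simp add: set_lebesgue_integral_def mult.commute diff_divide_distrib)
  have "(\<integral>x. ((\<eta> - x) * exp (g * x)) * indicator {0..\<eta>} x \<partial>lborel) =
      ((\<eta> - \<eta>) * exp (g * \<eta>) / g + exp (g * \<eta>) / g\<^sup>2) - ((\<eta> - 0) * exp (g * 0) / g + exp (g * 0) / g\<^sup>2)"
    using assms by (intro integral_FTC_Icc_real[where F = "\<lambda>x. (\<eta> - x) * exp (g * x) / g + exp (g * x) / g\<^sup>2"])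
      (auto intro!: derivative_eq_intros simp: field_simps power2_eq_square)
  then show "(LBINT x:{0..\<eta>}. (\<eta> - x) * exp (g * x)) = (exp (g * \<eta>) - 1 - g * \<eta>) / g\<^sup>2"
    using assms by (simp add: set_lebesgue_integral_def mult.commute field_simps power2_eq_square)
qed

section \<open>The threshold gap at the scale of the solution\<close>

lemma revenue_profile_quadratic_remainder_left:
  assumes r: "revenue_profile r" and deriv: "(r has_real_derivative rL') (at_left 0)"
  obtains C where "0 \<le> C" "\<And>x. x \<le> 0 \<Longrightarrow> \<bar>r x - (1 + rL' * x)\<bar> \<le> C * x\<^sup>2"
proof -
  note rp = revenue_profileD[OF r]
  have "{..0} - {0} = {..<0} - {0::real}" by auto
  then have at: "at 0 within {..0} = at_left (0::real)" by (simp add: at_within_def)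
  show thesis
  proof (rule piecewise_smooth_quadratic_remainder[of "{..0}" r rL' 1])
    show "piecewise_smooth_on {..0} r" using r by (simp add: revenue_profile_def)
    show "\<bar>r x - r 0\<bar> \<le> 1" for x using rp(1,2)[of x] by (simp add: rp(4))
  qed (use deriv that in \<open>auto simp: at rp(4)\<close>)
qed

lemma revenue_profile_quadratic_remainder_right:
  assumes r: "revenue_profile r" and deriv: "(r has_real_derivative rR') (at_right 0)"
  obtains C where "0 \<le> C" "\<And>x. 0 \<le> x \<Longrightarrow> \<bar>r x - (1 + rR' * x)\<bar> \<le> C * x\<^sup>2"
proof -
  note rp = revenue_profileD[OF r]
  have "{0..} - {0} = {0<..} - {0::real}" by auto
  then have at: "at 0 within {0..} = at_right (0::real)" by (simp add: at_within_def)
  show thesis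
  proof (rule piecewise_smooth_quadratic_remainder[of "{0..}" r rR' 1])
    show "piecewise_smooth_on {0..} r" using r by (simp add: revenue_profile_def)
    show "\<bar>r x - r 0\<bar> \<le> 1" for x using rp(1,2)[of x] by (simp add: rp(4))
  qed (use deriv that in \<open>auto simp: at rp(4)\<close>)
qed

text \<open>
  Here \<open>c\<close> stands for the drop \<open>1 - r \<eta>\<close>. The Gaussian factor differs from \<open>1\<close> by at most
  \<open>x\<^sup>2 / 2\<close>, so it only affects the remainder and the linear approximation \<open>c + a * x\<close> of the
  integrand is that of \<open>r x - (1 - c)\<close>.
\<close>
lemma left_gap_estimate:
  fixes g :: real
  assumes r: "revenue_profile r" and g: "0 < g" and c: "0 \<le> c" "c \<le> 1"
    and C: "\<And>x. x \<le> 0 \<Longrightarrow> \<bar>r x - (1 + a * x)\<bar> \<le> C * x\<^sup>2"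
  shows "\<bar>(LBINT x:{..0}. (r x - (1 - c)) * exp (- x\<^sup>2 / 2 - (- g) * x)) - (c / g - a / g\<^sup>2)\<bar>
    \<le> 2 * (C + 1) / g ^ 3"
proof -
  note rp = revenue_profileD[OF r]
  have bdd: "\<bar>r x - (1 - c)\<bar> \<le> 1" for x using rp(1,2)[of x] c by auto
  have eq: "(r x - (1 - c)) * exp (- x\<^sup>2 / 2 - (- g) * x) =
      ((r x - (1 - c)) * exp (- x\<^sup>2 / 2)) * exp (g * x)" for x
    by (simp add: exp_add[symmetric] mult.assoc)
  have int: "set_integrable lborel {..0} (\<lambda>x. (r x - (1 - c)) * exp (- x\<^sup>2 / 2 - (- g) * x))"
    by (rule set_integrable_gaussian_tilt[where B = 1]) (use rp(5) bdd in auto)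
  show ?thesis
    unfolding eq
  proof (rule laplace_linear_approx[OF g])
    show "set_integrable lborel {..0} (\<lambda>x. ((r x - (1 - c)) * exp (- x\<^sup>2 / 2)) * exp (g * x))"
      using int unfolding eq .
    fix x :: real assume x: "x \<le> 0"
    have e: "0 \<le> 1 - exp (- x\<^sup>2 / 2)" "1 - exp (- x\<^sup>2 / 2) \<le> x\<^sup>2 / 2"
      using exp_ge_add_one_self[of "- x\<^sup>2 / 2"] by auto
    have "\<bar>(r x - (1 - c)) * (1 - exp (- x\<^sup>2 / 2))\<bar> \<le> 1 * (x\<^sup>2 / 2)"
      unfolding abs_mult using e bdd by (intro mult_mono) auto
    moreover have "(r x - (1 - c)) * exp (- x\<^sup>2 / 2) - (c + a * x) =
        (r x - (1 + a * x)) - (r x - (1 - c)) * (1 - exp (- x\<^sup>2 / 2))"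
      by (simp add: algebra_simps)
    ultimately have "\<bar>(r x - (1 - c)) * exp (- x\<^sup>2 / 2) - (c + a * x)\<bar> \<le> C * x\<^sup>2 + x\<^sup>2 / 2"
      using C[OF x] by linarith
    also have "\<dots> \<le> (C + 1) * x\<^sup>2" by (simp add: distrib_right)
    finally show "\<bar>(r x - (1 - c)) * exp (- x\<^sup>2 / 2) - (c + a * x)\<bar> \<le> (C + 1) * x\<^sup>2" .
  qed
qed

text \<open>
  Replacing \<open>r\<close> by its linear approximation on \<open>{0..\<eta>}\<close> costs at most \<open>C * \<eta>\<^sup>2\<close> for each of
  \<open>r x\<close> and \<open>r \<eta>\<close>; the linearised integral is explicit.
\<close>
lemma right_gap_estimate:
  fixes g :: real
  assumes r: "revenue_profile r" and g: "0 < g" and \<eta>: "0 \<le> \<eta>" and C0: "0 \<le> C"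
    and C: "\<And>x. 0 \<le> x \<Longrightarrow> \<bar>r x - (1 - b * x)\<bar> \<le> C * x\<^sup>2"
  shows "\<bar>(LBINT x:{0..\<eta>}. (r x - r \<eta>) * exp (- (- g) * x)) - b * ((exp (g * \<eta>) - 1 - g * \<eta>) / g\<^sup>2)\<bar>
    \<le> 2 * C * \<eta>\<^sup>2 * ((exp (g * \<eta>) - 1) / g)"
proof -
  have int: "set_integrable lborel {0..\<eta>} (\<lambda>x. (r x - r \<eta>) * exp (g * x))"
    "set_integrable lborel {0..\<eta>} (\<lambda>x. b * ((\<eta> - x) * exp (g * x)))"
    "set_integrable lborel {0..\<eta>} (\<lambda>x. 2 * C * \<eta>\<^sup>2 * exp (g * x))"
    by (intro borel_integrable_atLeastAtMost' continuous_intros revenue_profileD(3)[OF r])+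
  have "\<bar>(LBINT x:{0..\<eta>}. (r x - r \<eta>) * exp (- (- g) * x)) - b * ((exp (g * \<eta>) - 1 - g * \<eta>) / g\<^sup>2)\<bar> =
      \<bar>LBINT x:{0..\<eta>}. (r x - r \<eta>) * exp (g * x) - b * ((\<eta> - x) * exp (g * x))\<bar>"
    using set_integral_diff(2)[OF int(1,2)] by (simp add: exp_linear_kernel_integral[OF g \<eta>])
  also have "\<dots> \<le> (LBINT x:{0..\<eta>}. 2 * C * \<eta>\<^sup>2 * exp (g * x))"
    unfolding set_lebesgue_integral_def
  proof (rule integral_abs_bound_integral)
    show "integrable lborel (\<lambda>x. indicator {0..\<eta>} x *\<^sub>R ((r x - r \<eta>) * exp (g * x) - b * ((\<eta> - x) * exp (g * x))))"
      using set_integral_diff(1)[OF int(1,2)] by (simp add: set_integrable_def)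
    show "integrable lborel (\<lambda>x. indicator {0..\<eta>} x *\<^sub>R (2 * C * \<eta>\<^sup>2 * exp (g * x)))"
      using int(3) by (simp add: set_integrable_def)
    fix x :: real
    have "\<bar>(r x - r \<eta>) * exp (g * x) - b * ((\<eta> - x) * exp (g * x))\<bar> \<le> 2 * C * \<eta>\<^sup>2 * exp (g * x)"
      if x: "0 \<le> x" "x \<le> \<eta>"
    proof -
      have "C * x\<^sup>2 \<le> C * \<eta>\<^sup>2" using x C0 by (intro mult_left_mono power_mono) auto
      moreover have "\<bar>(r x - (1 - b * x)) - (r \<eta> - (1 - b * \<eta>))\<bar> \<le> C * x\<^sup>2 + C * \<eta>\<^sup>2"
        using C[OF x(1)] C[OF \<eta>] by linarith
      ultimately have "\<bar>r x - r \<eta> - b * (\<eta> - x)\<bar> \<le> 2 * C * \<eta>\<^sup>2" by (simp add: algebra_simps)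
      then have "\<bar>r x - r \<eta> - b * (\<eta> - x)\<bar> * exp (g * x) \<le> 2 * C * \<eta>\<^sup>2 * exp (g * x)"
        by (rule mult_right_mono) simp
      moreover have "(r x - r \<eta>) * exp (g * x) - b * ((\<eta> - x) * exp (g * x)) =
          (r x - r \<eta> - b * (\<eta> - x)) * exp (g * x)"
        by (simp add: algebra_simps)
      ultimately show ?thesis by (simp add: abs_mult)
    qed
    then show "\<bar>indicator {0..\<eta>} x *\<^sub>R ((r x - r \<eta>) * exp (g * x) - b * ((\<eta> - x) * exp (g * x)))\<bar>
        \<le> indicator {0..\<eta>} x *\<^sub>R (2 * C * \<eta>\<^sup>2 * exp (g * x))"
      by (auto simp: indicator_def)
  qed
  also have "\<dots> = 2 * C * \<eta>\<^sup>2 * ((exp (g * \<eta>) - 1) / g)"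
    by (simp add: exp_linear_kernel_integral[OF g \<eta>])
  finally show ?thesis .
qed

text \<open>
  With \<open>\<eta> = t / g\<close> all three contributions to the gap are of order \<open>1 / g\<^sup>2\<close>. Writing
  \<open>b = - rR'\<close>, the loss on the left contributes \<open>- rL'\<close>, the drop of the level times the left
  mass contributes \<open>b * t\<close>, and the right part contributes \<open>b * (exp t - 1 - t)\<close>. The terms linear
  in \<open>t\<close> cancel, and the limit profile is \<open>b * (exp t - 1) - rL'\<close>, uniformly for bounded \<open>t\<close>.
\<close>
lemma rescaled_threshold_gap:
  assumes r: "revenue_profile r"
    and dL: "(r has_real_derivative rL') (at_left 0)" and dR: "(r has_real_derivative rR') (at_right 0)"
  obtains M where "0 < M"
    "\<And>g t. 0 < g \<Longrightarrow> 0 \<le> t \<Longrightarrow> t \<le> T \<Longrightarrow>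
       \<bar>g\<^sup>2 * threshold_gap r (- g) (t / g) - (- rR' * (exp t - 1) - rL')\<bar> \<le> M / g"
proof -
  obtain CL where CL: "0 \<le> CL" "\<And>x. x \<le> 0 \<Longrightarrow> \<bar>r x - (1 + rL' * x)\<bar> \<le> CL * x\<^sup>2"
    using revenue_profile_quadratic_remainder_left[OF r dL] by blast
  obtain CR where CR: "0 \<le> CR" "\<And>x. 0 \<le> x \<Longrightarrow> \<bar>r x - (1 + rR' * x)\<bar> \<le> CR * x\<^sup>2"
    using revenue_profile_quadratic_remainder_right[OF r dR] by blast
  define b where "b = - rR'"
  define m where "m t = 2 * (CL + 1) + CR * t\<^sup>2 + 2 * CR * t\<^sup>2 * (exp t - 1)" for t :: real
  show thesis
  proof (rule that)
    (* The absolute value keeps the constant positive when T is negative. *)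
    show "0 < m \<bar>T\<bar>" using CL(1) CR(1) by (simp add: m_def add_pos_nonneg)
    fix g t :: real
    assume g: "0 < g" and t: "0 \<le> t" "t \<le> T"
    define \<eta> where "\<eta> = t / g"
    have \<eta>: "0 \<le> \<eta>" "g * \<eta> = t" using g t by (auto simp: \<eta>_def)
    define c where "c = 1 - r \<eta>"
    define P where "P = (LBINT x:{..0}. (r x - r \<eta>) * exp (- x\<^sup>2 / 2 - (- g) * x))"
    define Q where "Q = (LBINT x:{0..\<eta>}. (r x - r \<eta>) * exp (- (- g) * x))"
    have gap: "threshold_gap r (- g) \<eta> = P + Q"
      by (simp add: P_def Q_def threshold_gap_eq_integrals[OF r])
    have "\<bar>P - (c / g - rL' / g\<^sup>2)\<bar> \<le> 2 * (CL + 1) / g ^ 3"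
      using left_gap_estimate[OF r g _ _ CL(2), of c] revenue_profileD(1,2)[OF r, of \<eta>]
      by (simp add: P_def c_def)
    then have "g\<^sup>2 * \<bar>P - (c / g - rL' / g\<^sup>2)\<bar> \<le> g\<^sup>2 * (2 * (CL + 1) / g ^ 3)"
      by (rule mult_left_mono) simp
    moreover have "g\<^sup>2 * \<bar>P - (c / g - rL' / g\<^sup>2)\<bar> = \<bar>g\<^sup>2 * P - (g * c - rL')\<bar>"
    proof -
      have "g\<^sup>2 * (P - (c / g - rL' / g\<^sup>2)) = g\<^sup>2 * P - (g * c - rL')"
        using g by (simp add: field_simps power2_eq_square)
      then show ?thesis by (metis abs_mult abs_power2)
    qed
    ultimately have P: "\<bar>g\<^sup>2 * P - (g * c - rL')\<bar> \<le> 2 * (CL + 1) / g"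
      using g by (simp add: power2_eq_square power3_eq_cube)
    have "\<bar>c - b * \<eta>\<bar> \<le> CR * \<eta>\<^sup>2"
      using CR(2)[OF \<eta>(1)] by (simp add: c_def b_def abs_minus_commute algebra_simps)
    then have "g * \<bar>c - b * \<eta>\<bar> \<le> g * (CR * \<eta>\<^sup>2)" using g by (intro mult_left_mono) auto
    moreover have "g * \<bar>c - b * \<eta>\<bar> = \<bar>g * c - b * t\<bar>"
    proof -
      have "g * (c - b * \<eta>) = g * c - b * t" using \<eta>(2) by (auto simp: algebra_simps)
      then show ?thesis using g by (metis abs_mult abs_of_pos)
    qed
    ultimately have c: "\<bar>g * c - b * t\<bar> \<le> CR * t\<^sup>2 / g"
      using g by (simp add: \<eta>_def power2_eq_square)
    have "\<bar>Q - b * ((exp t - 1 - t) / g\<^sup>2)\<bar> \<le> 2 * CR * \<eta>\<^sup>2 * ((exp t - 1) / g)"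
      using right_gap_estimate[OF r g \<eta>(1) CR(1), of b] CR(2) by (simp add: Q_def b_def \<eta>(2))
    then have "g\<^sup>2 * \<bar>Q - b * ((exp t - 1 - t) / g\<^sup>2)\<bar> \<le> g\<^sup>2 * (2 * CR * \<eta>\<^sup>2 * ((exp t - 1) / g))"
      by (rule mult_left_mono) simp
    moreover have "g\<^sup>2 * \<bar>Q - b * ((exp t - 1 - t) / g\<^sup>2)\<bar> = \<bar>g\<^sup>2 * Q - b * (exp t - 1 - t)\<bar>"
    proof -
      have "g\<^sup>2 * (Q - b * ((exp t - 1 - t) / g\<^sup>2)) = g\<^sup>2 * Q - b * (exp t - 1 - t)"
        using g by (simp add: field_simps)
      then show ?thesis by (metis abs_mult abs_power2)
    qed
    ultimately have Q: "\<bar>g\<^sup>2 * Q - b * (exp t - 1 - t)\<bar> \<le> 2 * CR * t\<^sup>2 * (exp t - 1) / g"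
      using g by (simp add: \<eta>_def power2_eq_square)
    have "g\<^sup>2 * threshold_gap r (- g) \<eta> - (- rR' * (exp t - 1) - rL') =
        (g\<^sup>2 * P - (g * c - rL')) + (g * c - b * t) + (g\<^sup>2 * Q - b * (exp t - 1 - t))"
      by (simp add: gap b_def algebra_simps)
    then have "\<bar>g\<^sup>2 * threshold_gap r (- g) \<eta> - (- rR' * (exp t - 1) - rL')\<bar> \<le> m t / g"
      using P c Q by (simp add: m_def add_divide_distrib)
    also have "m t \<le> m \<bar>T\<bar>"
      unfolding m_def using t CR(1) by (intro add_mono mult_mono power_mono order_refl) auto
    then have "m t / g \<le> m \<bar>T\<bar> / g" using g by (simp add: divide_right_mono)
    finally show "\<bar>g\<^sup>2 * threshold_gap r (- g) (t / g) - (- rR' * (exp t - 1) - rL')\<bar> \<le> m \<bar>T\<bar> / g"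
      by (simp add: \<eta>_def)
  qed
qed

text \<open>
  The limit profile vanishes at \<open>t0 = ln (1 - rL' / rR')\<close> and crosses zero there with positive
  slope. A shift of \<open>t\<close> by \<open>K / g\<close> to either side thus changes the profile by more than the
  error \<open>M / g\<close>, so the gap has opposite signs at the two shifted points. By monotonicity of the gap
  the root lies between them, and in terms of \<open>\<eta> = t / g\<close> the window has radius \<open>K / g\<^sup>2\<close>.
\<close>
lemma threshold_solution_near:
  assumes r: "revenue_profile r"
    and dL: "(r has_real_derivative rL') (at_left 0)" and dR: "(r has_real_derivative rR') (at_right 0)"
    and cusp: "rR' < 0" "0 < rL'"
  shows "\<exists>K g0. \<forall>g\<ge>g0. \<forall>\<eta>. threshold_solution r (- g) \<eta> \<longrightarrow>
    \<bar>\<eta> - ln (1 - rL' / rR') / g\<bar> \<le> K / g\<^sup>2"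
proof -
  define t0 where "t0 = ln (1 - rL' / rR')"
  have arg: "1 < 1 - rL' / rR'" using cusp by (simp add: divide_pos_neg)
  have t0: "0 < t0" "exp t0 = 1 - rL' / rR'" using arg by (auto simp: t0_def)
  obtain M where M: "0 < M"
    "\<And>g t. 0 < g \<Longrightarrow> 0 \<le> t \<Longrightarrow> t \<le> t0 + 1 \<Longrightarrow>
       \<bar>g\<^sup>2 * threshold_gap r (- g) (t / g) - (- rR' * (exp t - 1) - rL')\<bar> \<le> M / g"
    using rescaled_threshold_gap[OF r dL dR, of "t0 + 1"] by blast
  define b where "b = - rR'"
  have b: "0 < b" using cusp by (simp add: b_def)
  have profile: "- rR' * (exp t - 1) - rL' = b * exp t0 * (exp (t - t0) - 1)" for t
    using cusp by (simp add: b_def exp_diff t0(2) field_simps)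
  (* To the left of t0 only half of the slope is used, since exp (- u) \<le> 1 - u / 2 for u \<le> 1;
     with the factor 4 the profile there is still at most - 2 * (M / g). *)
  define K where "K = 4 * M / b"
  have K: "0 < K" "b * K = 4 * M" using M(1) b by (auto simp: K_def)
  show ?thesis
  (* The bound g \<ge> K keeps the shift u = K / g at most 1, and g \<ge> K / t0 keeps t0 - u \<ge> 0. *)
  proof (intro exI allI impI)
    fix g \<eta> :: real
    assume g: "max K (K / t0) \<le> g" and sol: "threshold_solution r (- g) \<eta>"
    have g_pos: "0 < g" using g K(1) by linarith
    define u where "u = K / g"
    have u: "0 < u" "u \<le> 1" "u \<le> t0" "b * u = 4 * (M / g)"
      using g g_pos K t0(1) by (auto simp: u_def field_simps)
    have root: "0 \<le> \<eta>" "threshold_gap r (- g) \<eta> = 0"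
      using sol by (auto simp: threshold_solution_iff_gap[OF r])
    have bt: "b \<le> b * exp t0" using b t0(1) by simp
    have "u \<le> exp u - 1" using exp_ge_add_one_self[of u] by linarith
    then have "b * u \<le> (b * exp t0) * (exp u - 1)"
      using bt b u(1) by (intro mult_mono) auto
    moreover have "\<bar>g\<^sup>2 * threshold_gap r (- g) ((t0 + u) / g) - b * exp t0 * (exp u - 1)\<bar> \<le> M / g"
      using M(2)[of g "t0 + u"] g_pos u t0(1) unfolding profile by simp
    moreover have Mg: "0 < M / g" using M(1) g_pos by simp
    ultimately have "0 < g\<^sup>2 * threshold_gap r (- g) ((t0 + u) / g)"
      using u(4) by linarith
    then have "0 < threshold_gap r (- g) ((t0 + u) / g)" by (simp add: zero_less_mult_iff)
    moreover have "0 \<le> (t0 + u) / g" using t0(1) u(1) g_pos by simp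
    ultimately have upper: "\<eta> < (t0 + u) / g"
      using threshold_gap_mono[OF r, of "(t0 + u) / g" \<eta> "- g"] root(2) by linarith
    have "exp (- u) * (1 + u) \<le> exp (- u) * exp u"
      using exp_ge_add_one_self[of u] by (intro mult_left_mono) auto
    also have "\<dots> = 1" by (simp add: exp_minus)
    also have "1 \<le> (1 - u / 2) * (1 + u)" 
    proof -
      have "u * u \<le> 1 * u" using u(1,2) by (intro mult_right_mono) auto
      then show ?thesis by (simp add: algebra_simps)
    qed
    finally have "exp (- u) \<le> 1 - u / 2" using u(1) by simp
    then have "b * (u / 2) \<le> (b * exp t0) * (1 - exp (- u))"
      using bt b u(1) by (intro mult_mono) auto
    moreover have "\<bar>g\<^sup>2 * threshold_gap r (- g) ((t0 - u) / g) - b * exp t0 * (exp (- u) - 1)\<bar> \<le> M / g"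
      using M(2)[of g "t0 - u"] g_pos u t0(1) unfolding profile by simp
    moreover have "b * exp t0 * (exp (- u) - 1) = - ((b * exp t0) * (1 - exp (- u)))"
      by (simp add: algebra_simps)
    moreover have "b * (u / 2) = 2 * (M / g)" using u(4) by simp
    ultimately have "g\<^sup>2 * threshold_gap r (- g) ((t0 - u) / g) < 0"
      using Mg by linarith
    then have "threshold_gap r (- g) ((t0 - u) / g) < 0" by (simp add: mult_less_0_iff)
    then have lower: "(t0 - u) / g < \<eta>"
      using threshold_gap_mono[OF r root(1), of "(t0 - u) / g" "- g"] root(2) by linarith
    have "u / g = K / g\<^sup>2" by (simp add: u_def power2_eq_square)
    then show "\<bar>\<eta> - ln (1 - rL' / rR') / g\<bar> \<le> K / g\<^sup>2"
      using upper lower unfolding t0_def[symmetric] by (simp add: add_divide_distrib diff_divide_distrib)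
  qed
qed

theorem proposition7:
  fixes r :: "real \<Rightarrow> real" and rL' rR' :: real
  assumes "revenue_profile r"
    and "(r has_real_derivative rL') (at_left 0)"
    and "(r has_real_derivative rR') (at_right 0)"
    and "rR' < 0" and "0 < rL'"
  shows "(\<forall>\<gamma>. \<exists>!\<eta>. threshold_solution r \<gamma> \<eta>) \<and>
    (\<lambda>\<gamma>. eta_opt r \<gamma> - (- (1 / \<gamma>) * ln (1 - rL' / rR'))) \<in> O[at_bot](\<lambda>\<gamma>. 1 / \<gamma>\<^sup>2)"
proof
  show ex1: "\<forall>\<gamma>. \<exists>!\<eta>. threshold_solution r \<gamma> \<eta>"
    using threshold_solution_ex1[OF assms(1)] by blast
  obtain K g0 where near: "\<forall>g\<ge>g0. \<forall>\<eta>. threshold_solution r (- g) \<eta> \<longrightarrow>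
      \<bar>\<eta> - ln (1 - rL' / rR') / g\<bar> \<le> K / g\<^sup>2"
    using threshold_solution_near[OF assms] by (elim exE)
  show "(\<lambda>\<gamma>. eta_opt r \<gamma> - (- (1 / \<gamma>) * ln (1 - rL' / rR'))) \<in> O[at_bot](\<lambda>\<gamma>. 1 / \<gamma>\<^sup>2)"
  proof (rule bigoI)
    show "\<forall>\<^sub>F \<gamma> in at_bot. norm (eta_opt r \<gamma> - (- (1 / \<gamma>) * ln (1 - rL' / rR'))) \<le> K * norm (1 / \<gamma>\<^sup>2)"
      using eventually_le_at_bot[of "- g0"]
    proof eventually_elim
      case (elim \<gamma>)
      have "threshold_solution r \<gamma> (eta_opt r \<gamma>)"
        unfolding eta_opt_def by (rule theI'[OF ex1[rule_format]])
      then show ?case using near[rule_format, of "- \<gamma>" "eta_opt r \<gamma>"] elim by simp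
    qed
  qed
qed

end
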